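(* Let ${\cal D}=(V,{\cal B})$ be a packing {\rm PD}$(v,k,1)$, let $\beta=\{B_1,\dots,B_t\}\subset{\cal B}$ be a set of $t$ blocks, and let ${\cal D}\setminus\beta=(V,{\cal B}\setminus\beta)$ be the design obtained by removing these blocks. Then \[\chi({\cal D})-\left\lceil\frac{t}{k-1}\right\rceil\le\chi({\cal D}\setminus\beta)\le\chi({\cal D}).\]
   Context: A packing design {\rm PD}$(v,k,1)$ is a pair $(V,{\cal B})$ with $|V|=v$ and ${\cal B}$ a collection of $k$-subsets (blocks) of $V$ such that every pair of points lies in at most one block. A weak $c$-colouring of a design is a map from its points to $c$ colours such that no block is monochromatic; the chromatic number $\chi$ is the least $c$ admitting a weak $c$-colouring. *)

theory Defs
  imports Complex_Main "HOL-Library.FuncSet"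
begin

(* For block size at least 2 the pair condition excludes repeated blocks,
   so the collection of blocks is a set rather than a multiset. *)
definition packing_design :: "nat \<Rightarrow> nat \<Rightarrow> 'a set \<Rightarrow> 'a set set \<Rightarrow> bool" where
  "packing_design v k V \<B> \<longleftrightarrow>
     finite V \<and> card V = v \<and>
     (\<forall>b\<in>\<B>. b \<subseteq> V \<and> card b = k) \<and>
     (\<forall>x\<in>V. \<forall>y\<in>V. x \<noteq> y \<longrightarrow> card {b\<in>\<B>. x \<in> b \<and> y \<in> b} \<le> 1)"

definition monochromatic :: "('a \<Rightarrow> nat) \<Rightarrow> 'a set \<Rightarrow> bool" where
  "monochromatic f b \<longleftrightarrow> (\<exists>i. \<forall>x\<in>b. f x = i)"

definition weak_colouring :: "'a set \<Rightarrow> 'a set set \<Rightarrow> nat \<Rightarrow> ('a \<Rightarrow> nat) \<Rightarrow> bool" where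
  "weak_colouring V \<B> c f \<longleftrightarrow> f \<in> V \<rightarrow> {..<c} \<and> (\<forall>b\<in>\<B>. \<not> monochromatic f b)"

definition chromatic_number :: "'a set \<Rightarrow> 'a set set \<Rightarrow> nat" where
  "chromatic_number V \<B> = (LEAST c. \<exists>f. weak_colouring V \<B> c f)"

(* The LEAST above is meaningful whenever the block size is at least 2. *)
lemma weak_colouring_exists:
  assumes "packing_design v k V \<B>" and "k \<ge> 2"
  shows "\<exists>f. weak_colouring V \<B> v f"
proof -
  have V: "finite V" "card V = v" and blk: "\<And>b. b \<in> \<B> \<Longrightarrow> b \<subseteq> V \<and> card b = k"
    using assms(1) by (auto simp: packing_design_def)
  obtain f where f: "bij_betw f V {0..<v}"
    using ex_bij_betw_finite_nat[OF V(1)] V(2) by auto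
  have "\<not> monochromatic f b" if b: "b \<in> \<B>" for b
  proof
    assume "monochromatic f b"
    then obtain i where "\<forall>x\<in>b. f x = i" by (auto simp: monochromatic_def)
    then have "f ` b \<subseteq> {i}" by auto
    moreover have "inj_on f b"
      using f blk[OF b] by (meson bij_betw_def inj_on_subset)
    ultimately have "card b \<le> card {i}" by (intro card_inj_on_le) auto
    then show False using blk[OF b] assms(2) by simp
  qed
  moreover have "f \<in> V \<rightarrow> {..<v}" using f by (auto simp: bij_betw_def)
  ultimately show ?thesis by (auto simp: weak_colouring_def)
qed

end

theory Submission
  imports Defs
begin

text \<open>
  Pick one point from each removed block and recolour the at most \<open>t\<close> chosen points with new
  colours, each new colour being used at most \<open>k - 1\<close> times. A new colour class is too small to
  contain a block, and an old colour class only shrinks while losing a point of every removed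
  block, so the recolouring is a weak colouring of the whole design.
\<close>

lemma weak_colouring_restore_blocks:
  assumes col: "weak_colouring V (\<B> - \<beta>) c f"
    and blk: "\<And>b. b \<in> \<B> \<Longrightarrow> b \<subseteq> V \<and> card b = k"
    and k: "k \<ge> 2" and fin: "finite \<beta>"
    and m: "card \<beta> \<le> m * (k - 1)"
  shows "\<exists>f'. weak_colouring V \<B> (c + m) f'"
proof -
  have ne: "b \<noteq> {}" if "b \<in> \<B>" for b
    using blk[OF that] k by auto
  obtain p where p: "\<And>b. b \<in> \<B> \<Longrightarrow> p b \<in> b"
    using ne by (metis ex_in_conv)
  \<comment> \<open>One point may be chosen from several removed blocks, so only an upper bound on
    \<open>card S\<close> is available, and it suffices.\<close>
  define S where "S = p ` \<beta>"
  have finS: "finite S" and cardS: "card S \<le> card \<beta>"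
    using fin by (simp_all add: S_def card_image_le)
  obtain h where h: "bij_betw h S {0..<card S}"
    using ex_bij_betw_finite_nat[OF finS] by auto
  \<comment> \<open>The numbering \<open>h\<close> cuts \<open>S\<close> into runs of at most
    \<open>k - 1\<close> points, one new colour per run. The shift by \<open>c\<close> keeps new
    colours apart from the values of \<open>f\<close> on \<open>V\<close>.\<close>
  define f' where "f' x = (if x \<in> S then c + h x div (k - 1) else f x)" for x
  have new: "h x div (k - 1) < m" if "x \<in> S" for x
  proof -
    have "h x < m * (k - 1)"
      using bij_betwE[OF h] that cardS m by force
    then show ?thesis by (simp add: less_mult_imp_div_less)
  qed
  have old: "f x < c" if "x \<in> V" for x
    using col that by (auto simp: weak_colouring_def)
  have "\<not> monochromatic f' b" if b: "b \<in> \<B>" for b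
  proof
    assume "monochromatic f' b"
    then obtain i where i: "\<And>x. x \<in> b \<Longrightarrow> f' x = i"
      by (auto simp: monochromatic_def)
    have bV: "b \<subseteq> V" and cb: "card b = k"
      using blk[OF b] by auto
    show False
    proof (cases "i < c")
      \<comment> \<open>Points of \<open>S\<close> have colours at least \<open>c\<close>, so
        \<open>b\<close> avoids \<open>S\<close>. Hence \<open>f'\<close> agrees with
        \<open>f\<close> on \<open>b\<close>, and \<open>b\<close> was not removed, since otherwise
        \<open>p b\<close> would lie in \<open>S\<close>.\<close>
      case True
      then have nS: "x \<notin> S" if "x \<in> b" for x
        using i[OF that] by (auto simp: f'_def)
      then have "monochromatic f b"
        using i by (auto simp: monochromatic_def f'_def)
      moreover have "b \<notin> \<beta>"
        using nS p[OF b] by (auto simp: S_def)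
      ultimately show False
        using col b by (auto simp: weak_colouring_def)
    next
      case False
      have bS: "x \<in> S" if "x \<in> b" for x
        using i[OF that] old[of x] bV that False by (auto simp: f'_def split: if_splits)
      have quot: "h x div (k - 1) = i - c" if "x \<in> b" for x
        using i[OF that] bS[OF that] by (auto simp: f'_def)
      \<comment> \<open>Equal quotients confine the numbers of the points of \<open>b\<close> to
        \<open>k - 1\<close> consecutive integers, but \<open>b\<close> has \<open>k\<close> points
        and \<open>h\<close> is injective.\<close>
      have "h ` b \<subseteq> {(i - c) * (k - 1)..<(i - c) * (k - 1) + (k - 1)}"
      proof
        fix y assume "y \<in> h ` b"
        then have "y div (k - 1) = i - c"
          using quot by auto
        moreover have "y mod (k - 1) < k - 1"
          using k by simp
        ultimately show "y \<in> {(i - c) * (k - 1)..<(i - c) * (k - 1) + (k - 1)}"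
          using div_mult_mod_eq[of y "k - 1"] by (metis add_less_cancel_left atLeastLessThan_iff le_add1)
      qed
      moreover have "inj_on h b"
        using h bS by (meson bij_betw_def inj_on_subset subsetI)
      ultimately have "card b \<le> card {(i - c) * (k - 1)..<(i - c) * (k - 1) + (k - 1)}"
        by (intro card_inj_on_le) auto
      then show False
        using cb k by simp
    qed
  qed
  moreover have "f' \<in> V \<rightarrow> {..<c + m}"
    using old new by (fastforce simp: f'_def)
  ultimately show ?thesis
    by (auto simp: weak_colouring_def)
qed

theorem theorem3p13:
  fixes V :: "'a set" and \<B> \<beta> :: "'a set set" and v k t :: nat
  assumes "packing_design v k V \<B>"
    and "k \<ge> 2"
    and "\<beta> \<subseteq> \<B>"
    and "card \<beta> = t"
  shows "int (chromatic_number V \<B>) - \<lceil>real t / (real k - 1)\<rceil>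
           \<le> int (chromatic_number V (\<B> - \<beta>))
       \<and> chromatic_number V (\<B> - \<beta>) \<le> chromatic_number V \<B>"
proof -
  have blk: "\<And>b. b \<in> \<B> \<Longrightarrow> b \<subseteq> V \<and> card b = k" and finV: "finite V"
    using assms(1) by (auto simp: packing_design_def)
  \<comment> \<open>This excludes the default value 0 of \<open>card\<close> on infinite sets, so
    \<open>t\<close> really counts the removed blocks.\<close>
  have fin: "finite \<beta>"
    using blk assms(3) finV by (meson finite_Pow_iff finite_subset PowI subset_iff)
  obtain f where "weak_colouring V \<B> (chromatic_number V \<B>) f"
    using LeastI_ex[of "\<lambda>c. \<exists>f. weak_colouring V \<B> c f"] weak_colouring_exists[OF assms(1,2)]
    unfolding chromatic_number_def by blast
  \<comment> \<open>Removing blocks only removes constraints, so an optimal colouring of the whole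
    design stays valid.\<close>
  then have f: "weak_colouring V (\<B> - \<beta>) (chromatic_number V \<B>) f"
    by (auto simp: weak_colouring_def)
  then have upper: "chromatic_number V (\<B> - \<beta>) \<le> chromatic_number V \<B>"
    unfolding chromatic_number_def[of V "\<B> - \<beta>"] by (intro Least_le) blast
  obtain g where g: "weak_colouring V (\<B> - \<beta>) (chromatic_number V (\<B> - \<beta>)) g"
    using LeastI_ex[of "\<lambda>c. \<exists>f. weak_colouring V (\<B> - \<beta>) c f"] f
    unfolding chromatic_number_def[of V "\<B> - \<beta>"] by blast
  \<comment> \<open>This is the least number of new colours for which \<open>m * (k - 1)\<close> is
    at least \<open>t\<close>, leaving room for a chosen point of every removed block.\<close>
  define m where "m = nat \<lceil>real t / (real k - 1)\<rceil>"
  have m: "int m = \<lceil>real t / (real k - 1)\<rceil>"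
  proof -
    have "0 \<le> real t / (real k - 1)"
      using assms(2) by simp
    then show ?thesis
      unfolding m_def by linarith
  qed
  have "real t / (real k - 1) \<le> real m"
    unfolding m_def by (rule real_nat_ceiling_ge)
  then have "real t \<le> real m * (real k - 1)"
    using assms(2) by (simp add: pos_divide_le_eq)
  \<comment> \<open>Truncated subtraction agrees with real subtraction here because \<open>k\<close>
    is at least 2.\<close>
  also have "\<dots> = real (m * (k - 1))"
    using assms(2) by (simp add: of_nat_diff)
  finally have "card \<beta> \<le> m * (k - 1)"
    using assms(4) by (simp only: of_nat_le_iff)
  then have "\<exists>f'. weak_colouring V \<B> (chromatic_number V (\<B> - \<beta>) + m) f'"
    using weak_colouring_restore_blocks[OF g blk assms(2) fin] by blast
  then have "chromatic_number V \<B> \<le> chromatic_number V (\<B> - \<beta>) + m"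
    unfolding chromatic_number_def[of V \<B>] by (rule Least_le)
  then show ?thesis
    using upper m by linarith
qed

end
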